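(* $k(4) = 60$. That is, there exists a distinct covering system all of whose moduli lie in $[4,60]$, and there is no distinct covering system all of whose moduli lie in $[4,59]$.
   Context: A covering system (covering) is a finite set of congruences $\{x \equiv r_i \pmod{n_i}\}$ with positive integer moduli such that every integer satisfies at least one of them. A covering is distinct if the moduli are pairwise distinct and all greater than $1$. For an integer $n\ge 2$, $k(n)$ denotes the least positive integer such that there exists a distinct covering system with all moduli in the interval $[n, k(n)]$. *)

theory Defs
  imports "HOL-Number_Theory.Cong"
begin

(* The pair (r, m) stands for the congruence x == r (mod m). *)

definition covering_system :: "(int \<times> nat) set \<Rightarrow> bool" where
  "covering_system C \<longleftrightarrow>
     finite C \<and> (\<forall>(r, m)\<in>C. 0 < m) \<and> (\<forall>x::int. \<exists>(r, m)\<in>C. [x = r] (mod int m))"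

definition distinct_covering :: "(int \<times> nat) set \<Rightarrow> bool" where
  "distinct_covering C \<longleftrightarrow>
     covering_system C \<and> inj_on snd C \<and> (\<forall>m\<in>snd ` C. 1 < m)"

definition has_distinct_covering_in :: "nat \<Rightarrow> nat \<Rightarrow> bool" where
  "has_distinct_covering_in n k \<longleftrightarrow> (\<exists>C. distinct_covering C \<and> snd ` C \<subseteq> {n..k})"

(* LEAST is unspecified when no such k exists, so an equation for covering_k n carries
   its intended meaning only together with the existence of a covering. *)
definition covering_k :: "nat \<Rightarrow> nat" where
  "covering_k n = (LEAST k. 0 < k \<and> has_distinct_covering_in n k)"

end

theory Submission
  imports Defs "HOL-Computational_Algebra.Primes"
begin

text \<open>
  Non-existence below 60. Let \<open>x\<close> be missed by all congruences whose modulus divides \<open>N\<close>. Then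
  so are the points \<open>x + k N\<close> with \<open>k < p\<close>, and a modulus whose \<open>p\<close>-part exceeds that of \<open>N\<close> meets
  at most one of them; hence at least \<open>p\<close> of those congruences hold for \<open>x\<close> modulo the gcd of their
  modulus with \<open>N\<close>. If there are fewer than \<open>p\<close> such moduli they are useless, which leaves
  the moduli dividing \<open>5040\<close>. The seven multiples of 7 then act as one class modulo 120, 16 and 48
  as one class modulo 24, and 9, 18, 36, 45 as one class modulo 12 and one modulo 30 that agree
  modulo 3. Treating the multiples of 5 in the same way, every point modulo 24 lies in one of seven
  classes of moduli 4, 6, 8, 12, 12, 24, 24, or satisfies at least five of eight congruences modulo
  1, 2, 3, 4, 6, 6, 8, 24. The seven classes cover at most 19 points and the second kind of points
  number at most 5, so everything is disjoint and the second kind contains a class modulo 6; a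
  parity consideration refutes this.
\<close>

section \<open>An explicit covering with moduli from 4 to 60\<close>

text \<open>The congruences modulo 16 and 48 together cover the class of 18 modulo 24. All classes but
  that of 85 modulo 120 are covered by the first list; the multiples of 7 in the second list take
  care of it, one for each residue modulo 7. The residues were found by a computer search.\<close>

definition base_congruences :: "(int \<times> nat) list" where
  "base_congruences =
    [(0, 4), (1, 5), (3, 6), (6, 8), (4, 9), (9, 10), (10, 12), (8, 15), (2, 16), (7, 18), (17, 20),
     (2, 24), (5, 30), (19, 36), (25, 40), (28, 45), (42, 48), (47, 60)]"

definition seven_congruences :: "(int \<times> nat) list" where
  "seven_congruences = [(0, 7), (1, 14), (16, 21), (17, 28), (25, 35), (19, 42), (13, 56)]"

lemma base_congruences_residues:
  "\<forall>y\<in>set [0..719]. y mod 120 = 85 \<or> (\<exists>(r, m)\<in>set base_congruences. y mod int m = r)"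
  by code_simp

lemma seven_congruences_residues:
  "\<forall>j\<in>set [0..6]. \<exists>(r, m)\<in>set seven_congruences. (120 * j + 85) mod int m = r"
  by code_simp

lemma congruences_cover_by_residues:
  fixes x n :: int
  assumes "\<exists>(r, m)\<in>set cs. (x mod n) mod int m = r"
    and "\<forall>(r, m)\<in>set cs. int m dvd n"
  shows "\<exists>(r, m)\<in>set cs. [x = r] (mod int m)"
proof -
  obtain r m where rm: "(r, m) \<in> set cs" "(x mod n) mod int m = r"
    using assms(1) by blast
  then have "int m dvd n"
    using assms(2) by blast
  then have "[x = r] (mod int m)"
    using rm(2) by (auto simp: cong_def mod_mod_cancel)
  then show ?thesis
    using rm(1) by blast
qed

lemma distinct_covering_4_60: "has_distinct_covering_in 4 60"
proof -
  let ?C = "set (base_congruences @ seven_congruences)"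
  have "\<exists>(r, m)\<in>?C. [x = r] (mod int m)" for x
  proof (cases "x mod 120 = 85")
    case False
    \<comment> \<open>720 is the least common multiple of the moduli in
      \<open>base_congruences\<close>, and 840 is that of \<open>seven_congruences\<close>. In the
      other case \<open>x mod 840\<close> depends only on \<open>x div 120\<close> modulo 7.\<close>
    have "x mod 720 \<in> set [0..719]"
      using pos_mod_bound[of 720 x] by simp
    moreover have "x mod 720 mod 120 \<noteq> 85"
      using False by (simp add: mod_mod_cancel)
    ultimately have "\<exists>(r, m)\<in>set base_congruences. (x mod 720) mod int m = r"
      using base_congruences_residues by blast
    then have "\<exists>(r, m)\<in>set base_congruences. [x = r] (mod int m)"
      by (rule congruences_cover_by_residues) (simp add: base_congruences_def)
    then show ?thesis by auto
  next
    case True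
    have "x div 120 mod 7 \<in> set [0..6]"
      using pos_mod_bound[of 7 "x div 120"] by simp
    moreover have "x mod 840 = 120 * (x div 120 mod 7) + 85"
      using zmod_zmult2_eq[of 7 x 120] True by simp
    ultimately have "\<exists>(r, m)\<in>set seven_congruences. (x mod 840) mod int m = r"
      using seven_congruences_residues by metis
    then have "\<exists>(r, m)\<in>set seven_congruences. [x = r] (mod int m)"
      by (rule congruences_cover_by_residues) (simp add: seven_congruences_def)
    then show ?thesis by auto
  qed
  moreover have "inj_on snd ?C" "snd ` ?C \<subseteq> {4..60}"
    by (simp_all add: base_congruences_def seven_congruences_def)
  ultimately have "distinct_covering ?C"
    unfolding distinct_covering_def covering_system_def by fastforce
  then show ?thesis
    using \<open>snd ` ?C \<subseteq> {4..60}\<close> unfolding has_distinct_covering_in_def by blast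
qed

section \<open>Fibres \<open>x + k * N\<close> and the deletion of prime powers\<close>

lemma cong_add_multiple_iff:
  fixes x N r m :: int
  assumes "m dvd N"
  shows "[x + k * N = r] (mod m) \<longleftrightarrow> [x = r] (mod m)"
proof -
  obtain c where "N = m * c" using assms ..
  then have "x + k * N = x + (k * c) * m" by simp
  then show ?thesis by (simp only: cong_def mod_mult_self1)
qed

text \<open>Two fibre points in one class would give \<open>m dvd (k - l) * N\<close>, hence
  \<open>k = l\<close>; so \<open>p\<close> points need \<open>p\<close> different pairs. Modulo
  \<open>gcd m N\<close> the whole fibre agrees with \<open>x\<close>.\<close>

lemma fibre_pigeonhole:
  fixes x N :: int and P :: "(int \<times> int) set"
  assumes "finite P"
    and hit: "\<And>k. k < p \<Longrightarrow> \<exists>(r, m)\<in>P. [x + int k * N = r] (mod m)"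
    and sep: "\<And>r m k. (r, m) \<in> P \<Longrightarrow> m dvd k * N \<Longrightarrow> int p dvd k"
  shows "p \<le> card {(r, m)\<in>P. [x = r] (mod gcd m N)}"
proof -
  have "\<forall>k\<in>{..<p}. \<exists>c. c \<in> P \<and> [x + int k * N = fst c] (mod snd c)"
    using hit by fastforce
  then obtain f where f: "\<And>k. k < p \<Longrightarrow> f k \<in> P \<and> [x + int k * N = fst (f k)] (mod snd (f k))"
    by (metis lessThan_iff)
  have "inj_on f {..<p}"
  proof (rule inj_onI)
    fix k l assume kl: "k \<in> {..<p}" "l \<in> {..<p}" "f k = f l"
    have "[x + int k * N = x + int l * N] (mod snd (f k))"
      using f[of k] f[of l] kl by (metis cong_sym cong_trans lessThan_iff)
    then have "snd (f k) dvd (int k - int l) * N"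
      by (simp add: cong_iff_dvd_diff left_diff_distrib)
    then have "int p dvd int k - int l"
      using sep[of "fst (f k)" "snd (f k)"] f[of k] kl by simp
    then show "k = l"
      using kl by (simp flip: cong_iff_dvd_diff add: cong_int_iff) (simp add: cong_def)
  qed
  moreover have "f ` {..<p} \<subseteq> {(r, m)\<in>P. [x = r] (mod gcd m N)}"
  proof clarify
    fix k r m assume k: "k < p" and e: "(r, m) = f k"
    have "(r, m) \<in> P" "[x + int k * N = r] (mod m)"
      using f[OF k] e by (metis, metis fst_conv snd_conv)
    then show "(r, m) \<in> P \<and> [x = r] (mod gcd m N)"
      using cong_dvd_modulus[of "x + int k * N" r m "gcd m N"]
      by (simp add: cong_add_multiple_iff)
  qed
  moreover have "finite {(r, m)\<in>P. [x = r] (mod gcd m N)}"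
    by (rule finite_subset[OF _ \<open>finite P\<close>]) auto
  ultimately show ?thesis
    using card_inj_on_le[of f "{..<p}"] by simp
qed

text \<open>The count runs over the list rather than a set, so that it unfolds to a plain sum and
  entries of \<open>ps\<close> may coincide.\<close>

lemma cover_fibre_reduction:
  fixes N :: int and ps qs :: "(int \<times> int) list"
  assumes cover: "\<And>x. \<exists>(r, m)\<in>set (qs @ ps). [x = r] (mod m)"
    and qs: "\<And>r m. (r, m) \<in> set qs \<Longrightarrow> m dvd N"
    and sep: "\<And>r m k. (r, m) \<in> set ps \<Longrightarrow> m dvd k * N \<Longrightarrow> int p dvd k"
  shows "(\<exists>(r, m)\<in>set qs. [x = r] (mod m)) \<or>
         p \<le> (\<Sum>(r, m)\<leftarrow>ps. of_bool ([x = r] (mod gcd m N)))"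
proof (rule disj_imp[THEN iffD2], rule impI)
  assume x: "\<not> (\<exists>(r, m)\<in>set qs. [x = r] (mod m))"
  have "p \<le> card {(r, m)\<in>set ps. [x = r] (mod gcd m N)}"
  proof (rule fibre_pigeonhole[OF _ _ sep])
    fix k
    show "\<exists>(r, m)\<in>set ps. [x + int k * N = r] (mod m)"
    proof -
      obtain r m where rm: "(r, m) \<in> set (qs @ ps)" "[x + int k * N = r] (mod m)"
        using cover[of "x + int k * N"] by blast
      have "(r, m) \<notin> set qs"
      proof
        assume "(r, m) \<in> set qs"
        with rm(2) have "[x = r] (mod m)"
          using cong_add_multiple_iff[OF qs] by blast
        with \<open>(r, m) \<in> set qs\<close> x show False by blast
      qed
      then show ?thesis
        using rm by auto
    qed
  qed auto
  also have "\<dots> = card (set (filter (\<lambda>(r, m). [x = r] (mod gcd m N)) ps))"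
    by (rule arg_cong[of _ _ card]) auto
  also have "\<dots> \<le> length (filter (\<lambda>(r, m). [x = r] (mod gcd m N)) ps)"
    by (rule card_length)
  also have "\<dots> = (\<Sum>(r, m)\<leftarrow>ps. of_bool ([x = r] (mod gcd m N)))"
    by (induction ps) auto
  finally show "p \<le> (\<Sum>(r, m)\<leftarrow>ps. of_bool ([x = r] (mod gcd m N)))" .
qed

text \<open>\<open>m\<close> divides both \<open>k * m\<close> and \<open>k * N\<close>, hence
  \<open>\<bar>k\<bar> * gcd m N\<close>. For concrete moduli this turns the hypothesis
  \<open>sep\<close> above into a check on numerals.\<close>

lemma dvd_if_mult_gcd_dvd:
  fixes N m k q :: int
  assumes "N \<noteq> 0" "q * gcd m N dvd m" "m dvd k * N"
  shows "q dvd k"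
proof -
  have "m dvd gcd (k * m) (k * N)"
    using assms(3) by simp
  then have "m dvd \<bar>k\<bar> * gcd m N"
    by (simp only: gcd_mult_distrib_int)
  then have "q * gcd m N dvd \<bar>k\<bar> * gcd m N"
    using assms(2) dvd_trans by blast
  then show ?thesis
    using assms(1) by simp
qed

text \<open>In the fibre reduction over an \<open>N\<close> with \<open>p\<close>-part
  \<open>p ^ (a - 1)\<close>, the count would have to reach \<open>p\<close> but has fewer than
  \<open>p\<close> summands.\<close>

lemma cover_drop_prime_power:
  fixes r :: "nat \<Rightarrow> int" and ms :: "nat list"
  assumes p: "prime p" and "0 < a" and "0 \<notin> set ms"
    and cover: "\<And>x. \<exists>m\<in>set ms. [x = r m] (mod int m)"
    and few: "length (filter (\<lambda>m. p ^ a dvd m) ms) < p"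
  shows "\<exists>m\<in>set (filter (\<lambda>m. \<not> p ^ a dvd m) ms). [x = r m] (mod int m)"
proof -
  define L where "L = Lcm (set ms)"
  have "L \<noteq> 0"
    using assms(3) by (simp add: L_def Lcm_0_iff)
  then obtain M where M: "L = p ^ multiplicity p L * M" "\<not> p dvd M"
    using p by (metis multiplicity_decompose' not_prime_unit)
  \<comment> \<open>\<open>M\<close> is the \<open>p\<close>-free part of the lcm, so every modulus
    without the factor \<open>p ^ a\<close> divides this \<open>N\<close>.\<close>
  define N where "N = p ^ (a - 1) * M"
  let ?qs = "map (\<lambda>m. (r m, int m)) (filter (\<lambda>m. \<not> p ^ a dvd m) ms)"
  let ?ps = "map (\<lambda>m. (r m, int m)) (filter (\<lambda>m. p ^ a dvd m) ms)"
  have dvd_N: "m dvd N" if m: "m \<in> set ms" "\<not> p ^ a dvd m" for m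
  proof -
    have "m \<noteq> 0" using m(1) assms(3) by metis
    then obtain e where e: "m = p ^ multiplicity p m * e" "\<not> p dvd e"
      using p by (metis multiplicity_decompose' not_prime_unit)
    have "multiplicity p m < a"
      using m(2) by (meson multiplicity_dvd' not_less)
    moreover have "e dvd M"
    proof -
      have "e dvd p ^ multiplicity p L * M"
        using m(1) e(1) M(1) by (metis L_def dvd_Lcm dvd_trans dvd_triv_right)
      moreover have "coprime e (p ^ multiplicity p L)"
        using e(2) p by (metis coprime_commute coprime_power_left_iff prime_imp_coprime)
      ultimately show ?thesis
        using coprime_dvd_mult_right_iff by blast
    qed
    ultimately show ?thesis
      unfolding N_def by (subst e(1)) (intro mult_dvd_mono le_imp_power_dvd; simp)
  qed
  have sep: "int p dvd k" if m: "p ^ a dvd m" "int m dvd k * int N" for m k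
  proof -
    have "int (p ^ a) dvd k * int N"
      using m by (meson dvd_trans int_dvd_int_iff)
    then have "int p ^ (a - 1) * int p dvd int p ^ (a - 1) * (k * int M)"
      using \<open>0 < a\<close> by (simp add: N_def ac_simps flip: power_Suc)
    then have "int p dvd k * int M"
      using p by (simp add: prime_gt_0_nat)
    then show ?thesis
      using M(2) p prime_dvd_mult_iff[of "int p" k "int M"] by simp
  qed
  have "(\<exists>(s, m)\<in>set ?qs. [x = s] (mod m)) \<or>
         p \<le> (\<Sum>(s, m)\<leftarrow>?ps. of_bool ([x = s] (mod gcd m (int N))))"
  proof (rule cover_fibre_reduction)
    fix y
    show "\<exists>(s, m)\<in>set (?qs @ ?ps). [y = s] (mod m)"
      using cover[of y] by (auto simp: image_iff)
  qed (use dvd_N sep in auto)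
  moreover have "(\<Sum>(s, m)\<leftarrow>cs. of_bool ([x = s] (mod gcd m (int N)))) \<le> length cs" for cs
    by (induction cs) (auto simp: of_bool_def)
  ultimately show ?thesis
    using few le_trans[of p _ "length ?ps"] by fastforce
qed

text \<open>An entry with too many multiples has no effect, so \<open>cover_prune\<close> needs no
  counting hypothesis and the counts are left to evaluation.\<close>

primrec prune :: "(nat \<times> nat) list \<Rightarrow> nat list \<Rightarrow> nat list" where
  "prune [] ms = ms"
| "prune (q # qs) ms = prune qs
     (if length (filter (\<lambda>m. fst q ^ snd q dvd m) ms) < fst q
      then filter (\<lambda>m. \<not> fst q ^ snd q dvd m) ms else ms)"

lemma cover_prune:
  fixes r :: "nat \<Rightarrow> int"
  assumes "\<And>p a. (p, a) \<in> set qs \<Longrightarrow> prime p \<and> 0 < a" and "0 \<notin> set ms"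
    and "\<And>x. \<exists>m\<in>set ms. [x = r m] (mod int m)"
  shows "\<exists>m\<in>set (prune qs ms). [x = r m] (mod int m)"
  using assms
proof (induction qs arbitrary: ms)
  case (Cons q qs)
  obtain p a where q: "q = (p, a)" by (cases q)
  have pa: "prime p" "0 < a" using Cons.prems(1)[of p a] q by simp_all
  define ms' where "ms' = (if length (filter (\<lambda>m. p ^ a dvd m) ms) < p
    then filter (\<lambda>m. \<not> p ^ a dvd m) ms else ms)"
  have "\<exists>m\<in>set ms'. [y = r m] (mod int m)" for y
    using cover_drop_prime_power[OF pa Cons.prems(2,3)] Cons.prems(3)[of y]
    unfolding ms'_def by presburger
  moreover have "0 \<notin> set ms'"
    using Cons.prems(2) unfolding ms'_def by simp
  moreover have "prime p' \<and> 0 < a'" if "(p', a') \<in> set qs" for p' a'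
    using Cons.prems(1)[of p' a'] that by simp
  ultimately have "\<exists>m\<in>set (prune qs ms'). [x = r m] (mod int m)"
    using Cons.IH[of ms'] by blast
  then show ?case
    unfolding ms'_def q by (simp only: prune.simps fst_conv snd_conv)
qed simp

section \<open>Solvability and counting for residue classes\<close>

lemma cong_pair_solvable:
  fixes a b m n :: int
  assumes "[a = b] (mod gcd m n)"
  shows "\<exists>x. [x = a] (mod m) \<and> [x = b] (mod n)"
proof -
  obtain u v where uv: "u * m + v * n = gcd m n"
    using bezout_int by blast
  obtain k where k: "a - b = gcd m n * k"
    using assms by (auto simp: cong_iff_dvd_diff)
  have "a - u * m * k - b = (v * k) * n"
    using k by (simp flip: uv add: algebra_simps)
  then have "n dvd a - u * m * k - b"
    by simp
  then show ?thesis
    by (intro exI[of _ "a - u * m * k"]) (simp add: cong_iff_dvd_diff)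
qed

lemma card_cong_le:
  fixes r :: int
  assumes "0 < m"
  shows "card {x\<in>{0..<int k * m}. [x = r] (mod m)} \<le> k"
proof -
  have "{x\<in>{0..<int k * m}. [x = r] (mod m)} \<subseteq> (\<lambda>j. r mod m + int j * m) ` {..<k}"
  proof clarsimp
    fix x assume x: "0 \<le> x" "x < int k * m" "[x = r] (mod m)"
    have "(x div m) * m < int k * m"
      using x(2) assms pos_mod_sign[of m x] div_mult_mod_eq[of x m] by linarith
    then have "x div m < int k" "0 \<le> x div m"
      using x(1) assms by (simp_all add: pos_imp_zdiv_nonneg_iff)
    moreover have "x = r mod m + (x div m) * m"
      using x(3) by (metis cong_def mod_div_mult_eq)
    ultimately show "x \<in> (\<lambda>j. r mod m + int j * m) ` {..<k}"
      by (intro image_eqI[of _ _ "nat (x div m)"]) auto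
  qed
  then show ?thesis
    using surj_card_le[of "{..<k}"] by simp
qed

text \<open>Equality case of the union bound: an overlap of \<open>A i\<close> with the other sets
  would make the union smaller than the sum of the cardinalities.\<close>

lemma disjoint_if_sum_card_le:
  assumes "finite I" "\<And>i. i \<in> I \<Longrightarrow> finite (A i)"
    and le: "(\<Sum>i\<in>I. card (A i)) \<le> card (\<Union>i\<in>I. A i)"
    and ij: "i \<in> I" "j \<in> I" "i \<noteq> j"
  shows "A i \<inter> A j = {}"
proof -
  let ?U = "\<Union>k\<in>I - {i}. A k"
  have fin: "finite (A i)" "finite ?U"
    using assms by auto
  have "(\<Union>i\<in>I. A i) = A i \<union> ?U"
    using ij by auto
  then have "card (\<Union>i\<in>I. A i) + card (A i \<inter> ?U) = card (A i) + card ?U"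
    using card_Un_Int[OF fin] by simp
  moreover have "card ?U \<le> (\<Sum>k\<in>I - {i}. card (A k))"
    using assms(1) by (intro card_UN_le) auto
  moreover have "(\<Sum>i\<in>I. card (A i)) = card (A i) + (\<Sum>k\<in>I - {i}. card (A k))"
    using assms(1) ij by (simp add: sum.remove)
  ultimately have "card (A i \<inter> ?U) = 0"
    using le by linarith
  then have "A i \<inter> ?U = {}"
    using fin by auto
  then show ?thesis
    using ij by auto
qed

text \<open>Each prime from 11 on has at most five multiples in the range, 49 and 32 have one, 25
  and 27 two. The survivors are the divisors of 5040.\<close>

lemma prune_4_59:
  "prune [(11,1), (13,1), (17,1), (19,1), (23,1), (29,1), (31,1), (37,1), (41,1), (43,1), (47,1),
     (53,1), (59,1), (7,2), (5,2), (3,3), (2,5)] [4..<60] =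
   [4,5,6,7,8,9,10,12,14,15,16,18,20,21,24,28,30,35,36,40,42,45,48,56]"
  by simp

section \<open>The weighted covering problem modulo 24\<close>

text \<open>The number of congruences modulo 2, 3, 4, 6, 6, 8 satisfied by \<open>x\<close>, after a translation that
  makes the residues modulo 3 and modulo 8 vanish. The one modulo 24 can only promote a single
  point from three hits to four, which the second summand in \<open>hits_bound\<close> accounts for.\<close>

definition hits :: "int \<Rightarrow> int \<Rightarrow> int \<Rightarrow> int \<Rightarrow> int \<Rightarrow> nat" where
  "hits s2 s4 a b x = of_bool (x mod 2 = s2) + of_bool (x mod 3 = 0) + of_bool (x mod 4 = s4)
     + of_bool (x mod 6 = a) + of_bool (x mod 6 = b) + of_bool (x mod 8 = 0)"

lemma hits_bound:
  "\<forall>s2\<in>set [0..1]. \<forall>s4\<in>set [0..3]. \<forall>a\<in>set [0..5]. \<forall>b\<in>set [0..5].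
     length (filter (\<lambda>x. 4 \<le> hits s2 s4 a b x) [0..23])
       + of_bool (\<exists>x\<in>set [0..23]. hits s2 s4 a b x = 3)
     \<le> 4 + of_bool (a = b \<and> a mod 2 = s2 \<and> a mod 3 = 0)"
  by code_simp

lemma cong_classes_meet_below:
  fixes r r' m m' n :: int
  assumes "[r = r'] (mod gcd m m')" "m dvd n" "m' dvd n" "0 < n"
  shows "\<exists>x\<in>{0..<n}. [x = r] (mod m) \<and> [x = r'] (mod m')"
proof -
  obtain y where "[y = r] (mod m)" "[y = r'] (mod m')"
    using cong_pair_solvable[OF assms(1)] by blast
  then show ?thesis
    using assms by (intro bexI[of _ "y mod n"]) (simp_all add: cong_def mod_mod_cancel)
qed

lemma mod_numeral_le:
  "x mod 2 \<le> 1" "x mod 4 \<le> 3" "x mod 6 \<le> 5" for x :: int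
  by (simp_all flip: zless_add1_eq)

text \<open>Counting leaves only 19 + 5 = 24 with all eight sets disjoint. Then \<open>r4\<close>,
  \<open>r8\<close> and \<open>e\<close> have the parity opposite to \<open>a\<close> and are
  pairwise incongruent modulo 4, which is impossible.\<close>

lemma no_weighted_cover_mod_24_normalised:
  fixes r4 :: int
  assumes cover: "\<And>x. (\<exists>(r, m)\<in>set [(r4, 4), (r6, 6), (r8, 8), (r12, 12), (e, 12), (r24, 24), (f, 24)].
        [x = r] (mod m)) \<or>
      (5::nat) \<le> (\<Sum>(r, m)\<leftarrow>[(s1, 1), (s2, 2), (s3, 3), (s4, 4), (a, 6), (b, 6), (s8, 8), (z, 24)].
        of_bool ([x = r] (mod m)))"
    and eb: "[e = b] (mod 3)" and s3: "[s3 = 0] (mod 3)" and s8: "[s8 = 0] (mod 8)"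
  shows False
proof -
  define W where "W x \<longleftrightarrow> (5::nat) \<le> (\<Sum>(r, m)\<leftarrow>[(s1, 1), (s2, 2), (s3, 3), (s4, 4), (a, 6), (b, 6), (s8, 8), (z, 24)].
        of_bool ([x = r] (mod m)))" for x :: int
  define S where "S = {x\<in>{0..<24::int}. W x}"
  define C where "C r m = {x\<in>{0..<24::int}. [x = r] (mod m)}" for r m
  define A where "A = (!) [C r4 4, C r6 6, C r8 8, C r12 12, C e 12, C r24 24, C f 24, S]"
  define H where "H = hits (s2 mod 2) (s4 mod 4) (a mod 6) (b mod 6)"
  define F where "F = filter (\<lambda>x. 4 \<le> H x) [0..23]"
  define T where "T = {x. x = z mod 24 \<and> (\<exists>y\<in>set [0..23]. H y = 3)}"
  \<comment> \<open>The congruences modulo 2, 3, 6 and 6 then agree on a common class modulo 6; only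
    in this case does \<open>hits_bound\<close> allow five points.\<close>
  define consistent where "consistent \<longleftrightarrow> a mod 6 = b mod 6 \<and> a mod 6 mod 2 = s2 mod 2 \<and> a mod 6 mod 3 = 0"
  \<comment> \<open>The congruence modulo 1 always holds, so five hits leave four for
    \<open>H\<close> and the congruence modulo 24.\<close>
  have W_H: "4 \<le> H x + of_bool (x mod 24 = z mod 24)" if "W x" for x
    using that s3 s8 unfolding W_def H_def hits_def cong_def
    by simp
  have "S \<subseteq> set F \<union> T"
  proof
    fix x assume "x \<in> S"
    then have x: "0 \<le> x" "x < 24" "W x" by (auto simp: S_def)
    show "x \<in> set F \<union> T"
    proof (cases "4 \<le> H x")
      case False
      then have "x mod 24 = z mod 24" "H x = 3"
        using W_H[OF x(3)] by (auto simp: of_bool_def split: if_splits)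
      then show ?thesis using x by (auto simp: T_def)
    qed (use x in \<open>auto simp: F_def\<close>)
  qed
  then have "card S \<le> card (set F \<union> T)"
    by (intro card_mono finite_UnI finite_set) (simp_all add: T_def)
  also have "\<dots> \<le> card (set F) + card T"
    by (rule card_Un_le)
  also have "\<dots> \<le> length F + of_bool (\<exists>x\<in>set [0..23]. H x = 3)"
    by (intro add_mono card_length) (cases "\<exists>x\<in>set [0..23]. H x = 3"; simp add: T_def)
  also have "\<dots> \<le> 4 + of_bool consistent"
    unfolding F_def H_def consistent_def
    by (rule hits_bound[rule_format]) (simp_all add: mod_numeral_le)
  finally have cardS: "card S \<le> 4 + of_bool consistent" .
  have cardC: "card (C r4 4) \<le> 6" "card (C r6 6) \<le> 4" "card (C r8 8) \<le> 3" "card (C r12 12) \<le> 2"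
      "card (C e 12) \<le> 2" "card (C r24 24) \<le> 1" "card (C f 24) \<le> 1"
    using card_cong_le[of 4 6 r4] card_cong_le[of 6 4 r6] card_cong_le[of 8 3 r8]
      card_cong_le[of 12 2 r12] card_cong_le[of 12 2 e] card_cong_le[of 24 1 r24] card_cong_le[of 24 1 f]
    by (simp_all add: C_def)
  have sum_le: "(\<Sum>i<8. card (A i)) \<le> 19 + card S"
    using cardC by (simp add: A_def numeral_eq_Suc lessThan_Suc)
  have "{0..<24} \<subseteq> (\<Union>i<8. A i)"
  proof
    fix x :: int assume x: "x \<in> {0..<24}"
    then have "x \<in> C r4 4 \<union> C r6 6 \<union> C r8 8 \<union> C r12 12 \<union> C e 12 \<union> C r24 24 \<union> C f 24 \<union> S"
      using cover[of x] unfolding W_def[symmetric] by (simp add: C_def S_def)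
    then show "x \<in> (\<Union>i<8. A i)"
      by (simp add: A_def numeral_eq_Suc lessThan_Suc) blast
  qed
  moreover have fin: "finite (A i)" if "i < 8" for i
  proof -
    have "finite (C r m)" "finite S" for r m
      unfolding C_def S_def by (auto intro: finite_subset[of _ "{0..<24}"])
    then show ?thesis
      using that by (auto simp: A_def numeral_eq_Suc less_Suc_eq)
  qed
  ultimately have "24 \<le> card (\<Union>i<8. A i)"
    using card_mono[of "\<Union>i<8. A i" "{0..<24::int}"] by simp
  moreover have "card (\<Union>i<8. A i) \<le> (\<Sum>i<8. card (A i))"
    by (rule card_UN_le) simp
  \<comment> \<open>24 is at most 19 + \<open>card S\<close>, so \<open>S\<close> must have the
    maximal five points and no bound has slack.\<close>
  ultimately have "consistent" and tight: "(\<Sum>i<8. card (A i)) \<le> card (\<Union>i<8. A i)"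
    using sum_le cardS by (auto simp: of_bool_def split: if_splits)
  have disj: "A i \<inter> A j = {}" if "i < 8" "j < 8" "i \<noteq> j" for i j
    using disjoint_if_sum_card_le[OF _ _ tight] fin that by simp
  \<comment> \<open>The congruences modulo 1, 2, 3, 6 and 6 all hold on this class, which makes five
    hits.\<close>
  have "C a 6 \<subseteq> S"
  proof
    fix x assume "x \<in> C a 6"
    moreover have "W x" if "x mod 6 = a mod 6"
    proof -
      have "x mod 2 = a mod 2" "x mod 3 = a mod 3"
        using that cong_dvd_modulus[of x a 6 2] cong_dvd_modulus[of x a 6 3] by (simp_all add: cong_def)
      then have "[x = s2] (mod 2)" "[x = s3] (mod 3)" "[x = a] (mod 6)" "[x = b] (mod 6)"
        using that \<open>consistent\<close> s3 by (simp_all add: consistent_def cong_def mod_mod_cancel)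
      then show ?thesis
        by (simp add: W_def)
    qed
    ultimately show "x \<in> S"
      by (simp add: C_def S_def cong_def)
  qed
  then have empty: "C r4 4 \<inter> C a 6 = {}" "C e 12 \<inter> C a 6 = {}" "C r8 8 \<inter> C a 6 = {}"
      "C r4 4 \<inter> C e 12 = {}" "C r8 8 \<inter> C e 12 = {}" "C r8 8 \<inter> C r4 4 = {}"
    using disj[of 0 7] disj[of 4 7] disj[of 2 7] disj[of 0 4] disj[of 2 4] disj[of 2 0]
    by (auto simp: A_def)
  have meet: "\<not> [r = r'] (mod gcd m m')" if d: "C r m \<inter> C r' m' = {}" "m dvd 24" "m' dvd 24" for r r' m m'
  proof
    assume "[r = r'] (mod gcd m m')"
    then obtain x where "x \<in> {0..<24}" "[x = r] (mod m)" "[x = r'] (mod m')"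
      using cong_classes_meet_below[of r r' m m' 24] d by auto
    then have "x \<in> C r m \<inter> C r' m'"
      by (simp add: C_def)
    with d(1) show False by blast
  qed
  have "odd (r4 - a)" "\<not> 6 dvd e - a" "odd (r8 - a)"
      and mod4: "\<not> 4 dvd r4 - e" "\<not> 4 dvd r8 - e" "\<not> 4 dvd r8 - r4"
    using meet[OF empty(1)] meet[OF empty(2)] meet[OF empty(3)]
      meet[OF empty(4)] meet[OF empty(5)] meet[OF empty(6)]
    by (simp_all add: cong_iff_dvd_diff gcd_non_0_int)
  \<comment> \<open>Here \<open>eb\<close> enters: with divisibility by 3 secured, failure of
    divisibility by 6 means odd difference.\<close>
  moreover have "3 dvd e - a"
  proof -
    have "[a = b] (mod 3)"
      using \<open>consistent\<close> cong_dvd_modulus[of a b 6 3] by (simp add: consistent_def cong_def)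
    then show ?thesis
      using eb by (metis cong_iff_dvd_diff cong_sym cong_trans)
  qed
  then have "odd (e - a)"
    using \<open>\<not> 6 dvd e - a\<close> by presburger
  ultimately obtain i j k where "r4 - a = 2 * i + 1" "r8 - a = 2 * j + 1" "e - a = 2 * k + 1"
    by (metis oddE)
  then have "r4 - e = 2 * (i - k)" "r8 - e = 2 * (j - k)" "r8 - r4 = 2 * (j - i)"
    by simp_all
  moreover have "4 dvd 2 * d" if "even d" for d :: int
    using that by presburger
  \<comment> \<open>The first number minus the second is \<open>i - j\<close>, so the three cannot
    all be odd.\<close>
  ultimately have "odd (i - k)" "odd (j - k)" "odd (j - i)"
    using mod4 by metis+
  then show False
    by simp
qed

lemma cong_shift_iff: "[x + t = r] (mod m) \<longleftrightarrow> [x = r - t] (mod m)" for x t r m :: int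
  by (simp add: cong_iff_dvd_diff algebra_simps)

text \<open>A translation by \<open>t\<close> makes \<open>s3\<close> and \<open>s8\<close> vanish
  modulo 3 and 8, which leaves fewer parameters to enumerate in \<open>hits_bound\<close>.\<close>

lemma no_weighted_cover_mod_24:
  fixes r4 :: int
  assumes cover: "\<And>x. (\<exists>(r, m)\<in>set [(r4, 4), (r6, 6), (r8, 8), (r12, 12), (e, 12), (r24, 24), (f, 24)].
        [x = r] (mod m)) \<or>
      (5::nat) \<le> (\<Sum>(r, m)\<leftarrow>[(s1, 1), (s2, 2), (s3, 3), (s4, 4), (a, 6), (b, 6), (s8, 8), (z, 24)].
        of_bool ([x = r] (mod m)))"
    and eb: "[e = b] (mod 3)"
  shows False
proof -
  obtain t where t: "[t = s3] (mod 3)" "[t = s8] (mod 8)"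
    using cong_pair_solvable[of s3 s8 3 8] by (auto simp: gcd_non_0_int)
  show False
  proof (rule no_weighted_cover_mod_24_normalised[of "r4 - t" "r6 - t" "r8 - t" "r12 - t" "e - t" "r24 - t" "f - t"
        "s1 - t" "s2 - t" "s3 - t" "s4 - t" "a - t" "b - t" "s8 - t" "z - t"])
    fix x
    show "(\<exists>(r, m)\<in>set [(r4 - t, 4), (r6 - t, 6), (r8 - t, 8), (r12 - t, 12), (e - t, 12), (r24 - t, 24), (f - t, 24)].
        [x = r] (mod m)) \<or>
      (5::nat) \<le> (\<Sum>(r, m)\<leftarrow>[(s1 - t, 1), (s2 - t, 2), (s3 - t, 3), (s4 - t, 4), (a - t, 6), (b - t, 6), (s8 - t, 8), (z - t, 24)].
        of_bool ([x = r] (mod m)))"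
      using cover[of "x + t"] by (simp only: cong_shift_iff list.set list.map split bex_simps)
  next
    show "[e - t = b - t] (mod 3)"
      using eb by (simp add: cong_iff_dvd_diff)
  qed (use t in \<open>simp_all add: cong_iff_dvd_diff dvd_diff_commute\<close>)
qed

section \<open>Elimination of the factors 7, 16, 9 and 5 in turn\<close>

lemma no_cover_4_59:
  fixes r :: "nat \<Rightarrow> int"
  assumes "\<And>x. \<exists>m\<in>{4..59}. [x = r m] (mod int m)"
  shows False
proof -
  let ?c = "\<lambda>m. (r m, int m)"
  let ?B = "[4, 5, 6, 8, 10, 12, 15, 20, 24, 30, 40]"
  have "\<exists>m\<in>set [4..<60]. [x = r m] (mod int m)" for x
    using assms[of x] unfolding set_upt by force
  moreover have "0 \<notin> set [4..<60]"
    unfolding set_upt by simp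
  ultimately have cover0: "\<exists>m\<in>set [4,5,6,7,8,9,10,12,14,15,16,18,20,21,24,28,30,35,36,40,42,45,48,56].
      [x = r m] (mod int m)" for x
    unfolding prune_4_59[symmetric] by (intro cover_prune) auto
  have step7: "(\<exists>(s, m)\<in>set (map ?c (?B @ [9, 18, 36, 45, 16, 48])). [x = s] (mod m)) \<or>
      (7::nat) \<le> (\<Sum>(s, m)\<leftarrow>map ?c [7, 14, 21, 28, 35, 42, 56]. of_bool ([x = s] (mod gcd m 720)))" for x
  proof (rule cover_fibre_reduction[OF _ _ dvd_if_mult_gcd_dvd])
    fix y
    show "\<exists>(s, m)\<in>set (map ?c (?B @ [9, 18, 36, 45, 16, 48]) @ map ?c [7, 14, 21, 28, 35, 42, 56]).
        [y = s] (mod m)"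
      using cover0[of y] by (simp del: One_nat_def) blast
  qed (auto simp: gcd_non_0_int)
  \<comment> \<open>A point missed so far satisfies all seven reduced congruences, of moduli 1, 2,
    3, 4, 5, 6, 8. Those modulo 3, 5 and 8 already fix it modulo 120.\<close>
  obtain z where z: "[z = r 21] (mod 3)" "[z = r 35] (mod 5)" "[z = r 56] (mod 8)"
  proof -
    obtain y where y: "[y = r 21] (mod 3)" "[y = r 35] (mod 5)"
      using cong_pair_solvable[of "r 21" "r 35" 3 5] by (auto simp: gcd_non_0_int)
    obtain z where z: "[z = y] (mod 15)" "[z = r 56] (mod 8)"
      using cong_pair_solvable[of y "r 56" 15 8] by (auto simp: gcd_non_0_int)
    have "[z = y] (mod 3)" "[z = y] (mod 5)"
      using cong_dvd_modulus[OF z(1)] by simp_all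
    then show ?thesis
      using y z(2) that cong_trans by blast
  qed
  have cover7: "(\<exists>(s, m)\<in>set (map ?c (?B @ [9, 18, 36, 45, 16, 48])). [x = s] (mod m)) \<or>
      [x = z] (mod 120)" for x
  proof -
    have "[x = z] (mod 120)"
      if "(7::nat) \<le> (\<Sum>(s, m)\<leftarrow>map ?c [7, 14, 21, 28, 35, 42, 56]. of_bool ([x = s] (mod gcd m 720)))"
    proof -
      have "[x = r 21] (mod 3)" "[x = r 35] (mod 5)" "[x = r 56] (mod 8)"
        using that by (simp_all add: gcd_non_0_int of_bool_def split: if_splits)
      then have "[x = z] (mod 3)" "[x = z] (mod 5)" "[x = z] (mod 8)"
        using z by (meson cong_sym cong_trans)+
      then show ?thesis
        unfolding cong_iff_dvd_diff by presburger
    qed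
    then show ?thesis
      using step7[of x] by blast
  qed
  have cover16: "(\<exists>(s, m)\<in>set (map ?c (?B @ [9, 18, 36, 45]) @ [(z, 120)]). [x = s] (mod m)) \<or>
      [x = r 48] (mod 24)" for x
  proof -
    have "(\<exists>(s, m)\<in>set (map ?c (?B @ [9, 18, 36, 45]) @ [(z, 120)]). [x = s] (mod m)) \<or>
      (2::nat) \<le> (\<Sum>(s, m)\<leftarrow>map ?c [16, 48]. of_bool ([x = s] (mod gcd m 360)))"
    proof (rule cover_fibre_reduction[OF _ _ dvd_if_mult_gcd_dvd])
      fix y
      show "\<exists>(s, m)\<in>set ((map ?c (?B @ [9, 18, 36, 45]) @ [(z, 120)]) @ map ?c [16, 48]).
          [y = s] (mod m)"
        using cover7[of y] by simp blast
    qed (auto simp: gcd_non_0_int)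
    \<comment> \<open>Both reduced congruences must hold, modulo 8 and modulo 24; only the second is
      kept.\<close>
    then show ?thesis
      by (rule disj_forward) (simp_all add: gcd_non_0_int of_bool_def split: if_splits)
  qed
  define U where "U x \<longleftrightarrow> (\<exists>(s, m)\<in>set (map ?c ?B @ [(z, 120), (r 48, 24)]). [x = s] (mod m))" for x
  have step9: "U x \<or>
      (3::nat) \<le> (\<Sum>(s, m)\<leftarrow>map ?c [9, 18, 36, 45]. of_bool ([x = s] (mod gcd m 120)))" for x
    unfolding U_def
  proof (rule cover_fibre_reduction[OF _ _ dvd_if_mult_gcd_dvd])
    fix y
    show "\<exists>(s, m)\<in>set ((map ?c ?B @ [(z, 120), (r 48, 24)]) @ map ?c [9, 18, 36, 45]). [y = s] (mod m)"
      using cover16[of y] by simp blast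
  qed (auto simp: gcd_non_0_int)
  \<comment> \<open>The reduced moduli are 3, 6, 12, 15, and at least three of the four congruences
    hold: either the one of 36 with one of 9 and 18, or all but that of 36.\<close>
  have three_cases: "[x = r 36] (mod 12) \<and> ([x = r 9] (mod 3) \<or> [x = r 18] (mod 6)) \<or>
      [x = r 9] (mod 3) \<and> [x = r 18] (mod 6) \<and> [x = r 45] (mod 15)" if "\<not> U x" for x
    using step9[of x] that unfolding U_def
    by (auto simp: gcd_non_0_int of_bool_def split: if_splits)
  obtain e w where ew: "[e = w] (mod 3)" and
    cover9: "\<And>x. U x \<or> [x = e] (mod 12) \<or> [x = w] (mod 30)"
  proof (cases "\<exists>y. \<not> U y \<and> \<not> [y = r 36] (mod 12)")
    case False
    \<comment> \<open>The class modulo 12 suffices; \<open>w\<close> is a dummy chosen congruent to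
      \<open>e\<close>.\<close>
    then show ?thesis
      by (intro that[of "r 36" "r 36"]) auto
  next
    case True
    then obtain y where "\<not> U y" "\<not> [y = r 36] (mod 12)"
      by blast
    then have y: "[y = r 9] (mod 3)" "[y = r 18] (mod 6)" "[y = r 45] (mod 15)"
      using three_cases by blast+
    have y30: "[x = y] (mod 30)" if "\<not> U x" "\<not> [x = r 36] (mod 12)" for x
    proof -
      have "[x = y] (mod 6)" "[x = y] (mod 15)"
        using three_cases[OF that(1)] that(2) y by (meson cong_sym cong_trans)+
      then have "6 dvd x - y" "15 dvd x - y"
        by (simp_all add: cong_iff_dvd_diff)
      then show ?thesis
        unfolding cong_iff_dvd_diff by presburger
    qed
    show ?thesis
    \<comment> \<open>If the residues differ modulo 3, no point outside \<open>U\<close> lies in the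
      class of \<open>r 36\<close>, so \<open>e\<close> is free and can be set to
      \<open>y\<close>.\<close>
    proof (cases "[r 36 = y] (mod 3)")
      case True
      then show ?thesis
        using y30 by (intro that[of "r 36" y]) auto
    next
      case False
      have "\<not> [x = r 36] (mod 12)" if "\<not> U x" for x
      proof
        assume x36: "[x = r 36] (mod 12)"
        have "[x = y] (mod 3) \<or> [x = y] (mod 6)"
          using three_cases[OF that] y by (meson cong_sym cong_trans)
        then have "[x = y] (mod 3)"
          by (auto intro: cong_dvd_modulus)
        moreover have "[x = r 36] (mod 3)"
          using x36 by (rule cong_dvd_modulus) simp
        ultimately show False
          using False by (meson cong_sym cong_trans)
      qed
      then show ?thesis
        using y30 by (intro that[of y y]) auto
    qed
  qed
  \<comment> \<open>Removing the factor 5 from 5, 10, 15, 20, 30, 30, 40, 120 gives the eight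
    weighted moduli.\<close>
  have step5: "(\<exists>(s, m)\<in>set [?c 4, ?c 6, ?c 8, ?c 12, (e, 12), ?c 24, (r 48, 24)]. [x = s] (mod m)) \<or>
      (5::nat) \<le> (\<Sum>(s, m)\<leftarrow>[?c 5, ?c 10, ?c 15, ?c 20, ?c 30, (w, 30), ?c 40, (z, 120)].
        of_bool ([x = s] (mod gcd m 24)))" for x
  proof (rule cover_fibre_reduction[OF _ _ dvd_if_mult_gcd_dvd])
    fix y
    show "\<exists>(s, m)\<in>set ([?c 4, ?c 6, ?c 8, ?c 12, (e, 12), ?c 24, (r 48, 24)]
        @ [?c 5, ?c 10, ?c 15, ?c 20, ?c 30, (w, 30), ?c 40, (z, 120)]). [y = s] (mod m)"
      using cover9[of y] unfolding U_def by simp blast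
  qed (auto simp: gcd_non_0_int)
  show False
  proof (rule no_weighted_cover_mod_24[OF _ ew])
    fix x
    show "(\<exists>(s, m)\<in>set [(r 4, 4), (r 6, 6), (r 8, 8), (r 12, 12), (e, 12), (r 24, 24), (r 48, 24)].
        [x = s] (mod m)) \<or>
      (5::nat) \<le> (\<Sum>(s, m)\<leftarrow>[(r 5, 1), (r 10, 2), (r 15, 3), (r 20, 4), (r 30, 6), (w, 6), (r 40, 8), (z, 24)].
        of_bool ([x = s] (mod m)))"
      using step5[of x] by (simp add: gcd_non_0_int)
  qed
qed

section \<open>The value of \<open>covering_k 4\<close>\<close>

lemma no_distinct_covering_4_59: "\<not> has_distinct_covering_in 4 59"
proof
  assume "has_distinct_covering_in 4 59"
  then obtain C where C: "covering_system C" "inj_on snd C" "snd ` C \<subseteq> {4..59}"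
    unfolding has_distinct_covering_in_def distinct_covering_def by blast
  \<comment> \<open>For an \<open>m\<close> that is not a modulus of \<open>C\<close> the value is
    arbitrary; an extra class does not harm a cover.\<close>
  define r where "r m = fst (inv_into C snd m)" for m
  have "\<exists>m\<in>{4..59}. [x = r m] (mod int m)" for x
  proof -
    obtain a m where am: "(a, m) \<in> C" "[x = a] (mod int m)"
      using C(1) unfolding covering_system_def by blast
    have "r m = a"
      using inv_into_f_f[OF C(2) am(1)] by (simp add: r_def)
    moreover have "m \<in> {4..59}"
      using C(3) am(1) by force
    ultimately show ?thesis
      using am(2) by blast
  qed
  then show False
    by (rule no_cover_4_59)
qed

lemma has_distinct_covering_in_mono:
  "has_distinct_covering_in n k \<Longrightarrow> k \<le> l \<Longrightarrow> has_distinct_covering_in n l"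
  unfolding has_distinct_covering_in_def by (meson atLeastatMost_subset_iff order_refl subset_trans)

theorem theorem2:
  shows "covering_k 4 = 60 \<and>
         has_distinct_covering_in 4 60 \<and>
         \<not> has_distinct_covering_in 4 59"
proof -
  have "covering_k 4 = 60"
    unfolding covering_k_def
  proof (rule Least_equality)
    fix k assume "0 < k \<and> has_distinct_covering_in 4 k"
    then show "60 \<le> k"
      using has_distinct_covering_in_mono[of 4 k 59] no_distinct_covering_4_59 by linarith
  qed (simp add: distinct_covering_4_60)
  then show ?thesis
    using distinct_covering_4_60 no_distinct_covering_4_59 by blast
qed

end
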